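(* Let $n\ge2$, let \[ \pi>\mu_1\ge\mu_2\ge\cdots\ge\mu_n>-\pi/2,\qquad \mu_1-\mu_n<\pi, \] and let $M=\operatorname{diag}(e^{\mathrm{i}\mu_1},\ldots,e^{\mathrm{i}\mu_n})$. If $\mu_1>\pi/2$, then \[ \theta_{\mathbb{C}}(M)=\pi-\mu_1\le\theta_{\mathbb{R}}(M), \] where \[ \theta_{\mathbb{R}}(M)=\arccos\!\left(-\frac{\cos((\mu_1+\mu_2)/2)}{\cos((\mu_1-\mu_2)/2)}\right)\quad\text{if }\mu_1+\mu_2>\pi, \] and $\theta_{\mathbb{R}}(M)=\infty$ otherwise. Moreover, the inequality is strict if $\mu_1>\mu_2$.
   Context: For a square matrix $A$, $\operatorname{H}(A)=\tfrac12(A+A^* )$, and $\succ0$ means positive definite. A matrix $A\in\mathbb{C}^{n\times n}$ is *sectorial* if $0$ is not in its numerical range $\{x^*Ax: x\in\mathbb{C}^n,\|x\|=1\}$. A sectorial $A$ can be written as $A=T^*\operatorname{diag}(e^{\mathrm{i}\phi_1},\ldots,e^{\mathrm{i}\phi_n})T$ with $T\in\mathbb{C}^{n\times n}$ invertible and $\phi_1\ge\cdots\ge\phi_n$ in an interval of length strictly less than $\pi$; once the interval is chosen (a choice only affects all phases by a common multiple of $2\pi$) these numbers are uniquely determined and are called the *phases* $\phi_1(A)\ge\cdots\ge\phi_n(A)$. We fix the choice so that $\tfrac12(\phi_1(A)+\phi_n(A))\in(-\pi,\pi]$. In particular, real $\Delta$ with $\operatorname{H}(\Delta)\succ0$ are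 sectorial with phases in $(-\pi/2,\pi/2)$. The numbers $\phi_1(A)$ and $\phi_n(A)$ are the largest and smallest arguments of $x^*Ax$ over unit $x\in\mathbb{C}^n$. The complex and real angular stability radii of a sectorial $M\in\mathbb{C}^{n\times n}$ are \[ \theta_{\mathbb{C}}(M):=\inf\{\max\{|\phi_1(\Delta)|,|\phi_n(\Delta)|\}:\Delta\in\mathbb{C}^{n\times n}\text{ sectorial},\ \det(I+M\Delta)=0\}, \] \[ \theta_{\mathbb{R}}(M):=\inf\{\phi_1(\Delta):\Delta\in\mathbb{R}^{n\times n},\ \operatorname{H}(\Delta)\succ0,\ \det(I+M\Delta)=0\}, \] with $\inf\emptyset=+\infty$. *)

theory Defs
  imports
    "HOL-Library.Extended_Real"
    "Jordan_Normal_Form.Schur_Decomposition"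
begin

text \<open>
  The library's \<open>u \<bullet>c v\<close> conjugates its second argument, so \<open>(A *\<^sub>v x) \<bullet>c x\<close> is
  the complex number \<open>x\<^sup>* A x\<close>, and \<open>x \<bullet>c x = 1\<close> says that \<open>x\<close> is a unit vector.
\<close>

definition numerical_range :: "complex mat \<Rightarrow> complex set" where
  "numerical_range A = {(A *\<^sub>v x) \<bullet>c x |x. x \<in> carrier_vec (dim_row A) \<and> x \<bullet>c x = 1}"

definition sectorial :: "complex mat \<Rightarrow> bool" where
  "sectorial A \<longleftrightarrow> square_mat A \<and> 0 \<notin> numerical_range A"

definition herm_part :: "complex mat \<Rightarrow> complex mat" where
  "herm_part A = (1 / 2) \<cdot>\<^sub>m (A + mat_adjoint A)"

text \<open>The order on complex numbers: \<open>0 < z\<close> means that \<open>z\<close> is real and positive.\<close>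

definition pos_def :: "complex mat \<Rightarrow> bool" where
  "pos_def A \<longleftrightarrow> square_mat A \<and> mat_adjoint A = A \<and>
     (\<forall>x \<in> carrier_vec (dim_row A). x \<noteq> 0\<^sub>v (dim_row A) \<longrightarrow> 0 < (A *\<^sub>v x) \<bullet>c x)"

text \<open>
  Sequences \<open>\<phi> 1, \<dots>, \<phi> n\<close> are indexed from 1 (values elsewhere are irrelevant), whereas
  matrix entries are indexed from 0.
\<close>

definition diag_cis :: "nat \<Rightarrow> (nat \<Rightarrow> real) \<Rightarrow> complex mat" where
  "diag_cis n \<phi> = mat_diag n (\<lambda>i. cis (\<phi> (Suc i)))"

text \<open>
  \<open>phases A \<phi>\<close>: the numbers \<open>\<phi> 1 \<ge> \<dots> \<ge> \<phi> n\<close> are the phases of the \<open>n \<times> n\<close> matrix \<open>A\<close>.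
  Every sectorial matrix has exactly one such list; the last condition fixes the common
  multiple of \<open>2 * pi\<close>.
\<close>

definition phases :: "complex mat \<Rightarrow> (nat \<Rightarrow> real) \<Rightarrow> bool" where
  "phases A \<phi> \<longleftrightarrow> (let n = dim_row A in
     (\<exists>T \<in> carrier_mat n n. invertible_mat T \<and> A = mat_adjoint T * diag_cis n \<phi> * T) \<and>
     antimono_on {1..n} \<phi> \<and>
     \<phi> 1 - \<phi> n < pi \<and>
     - pi < (\<phi> 1 + \<phi> n) / 2 \<and> (\<phi> 1 + \<phi> n) / 2 \<le> pi)"

text \<open>The infima are taken in the extended reals, where the empty set has infimum \<open>\<infinity>\<close>.\<close>

definition theta_complex :: "complex mat \<Rightarrow> ereal" where
  "theta_complex M = (let n = dim_row M in
     Inf {ereal (max \<bar>\<phi> 1\<bar> \<bar>\<phi> n\<bar>) |\<Delta> \<phi>.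
       \<Delta> \<in> carrier_mat n n \<and> sectorial \<Delta> \<and> phases \<Delta> \<phi> \<and> det (1\<^sub>m n + M * \<Delta>) = 0})"

definition theta_real :: "complex mat \<Rightarrow> ereal" where
  "theta_real M = (let n = dim_row M in
     Inf {ereal (\<phi> 1) |(\<Delta>\<^sub>R :: real mat) \<Delta> \<phi>.
       \<Delta>\<^sub>R \<in> carrier_mat n n \<and> \<Delta> = map_mat complex_of_real \<Delta>\<^sub>R \<and>
       pos_def (herm_part \<Delta>) \<and> phases \<Delta> \<phi> \<and> det (1\<^sub>m n + M * \<Delta>) = 0})"

end

theory Submission
  imports Defs
begin

text \<open>
  Put \<open>\<psi>\<^sub>i = \<pi> - \<mu>\<^sub>i\<close>. Then \<open>det (I + M \<Delta>) = 0\<close> means \<open>\<Delta> x = diag (e^(i \<psi>\<^sub>1), \<dots>, e^(i \<psi>\<^sub>n)) x\<close> for some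
  \<open>x \<noteq> 0\<close>, so \<open>x\<^sup>* \<Delta> x\<close> lies in the cone spanned by the \<open>e^(i \<psi>\<^sub>i)\<close>. If all phases of \<open>\<Delta>\<close> were below
  \<open>\<psi>\<^sub>1\<close> in modulus, \<open>x\<^sup>* \<Delta> x\<close> would lie strictly on the other side of the ray through \<open>e^(i \<psi>\<^sub>1)\<close>; this
  gives the complex radius, which is attained by \<open>e^(i \<psi>\<^sub>1) I\<close>.

  For real \<open>\<Delta>\<close> the value \<open>\<Delta> y\<close> is also known for \<open>y = a x + b x'\<close>, where \<open>x'\<close> is the entrywise
  conjugate of \<open>x\<close>. With \<open>c = \<Sum> e^(i \<psi>\<^sub>i) \<bar>x\<^sub>i\<bar>\<^sup>2\<close>, \<open>q = \<Sum> e^(i \<psi>\<^sub>i) x\<^sub>i\<^sup>2\<close>, real \<open>a\<close> and a suitable argument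
  of \<open>b\<close>, the number \<open>y\<^sup>* \<Delta> y\<close> has real part \<open>(a\<^sup>2 + \<bar>b\<bar>\<^sup>2) Re c - 2 a \<bar>b\<bar> \<bar>q\<bar>\<close> and imaginary part
  \<open>(a\<^sup>2 - \<bar>b\<bar>\<^sup>2) Im c\<close>. Let \<open>s\<close> and \<open>d\<close> be half the sum and half the difference of \<open>\<psi>\<^sub>2\<close> and \<open>\<psi>\<^sub>1\<close>.
  Since \<open>\<bar>q\<bar> \<ge> \<bar>x\<^sub>1\<bar>\<^sup>2 - \<Sum>\<^sub>j\<^sub>>\<^sub>1 \<bar>x\<^sub>j\<bar>\<^sup>2\<close>, an inequality linear in the \<open>\<bar>x\<^sub>i\<bar>\<^sup>2\<close> yields
  \<open>sin s Re c - sin d \<bar>q\<bar> \<le> cos s Im c\<close>. For \<open>s < \<pi>/2\<close> it produces a \<open>y\<close> whose argument is at least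
  \<open>arccos (cos s / cos d)\<close>, a value attained by a plane rotation in the first two coordinates.
  For \<open>s \<ge> \<pi>/2\<close> the same inequality with \<open>\<pi>/2\<close> and \<open>\<pi>/2 - \<psi>\<^sub>1\<close> in place of \<open>s\<close> and \<open>d\<close> contradicts the
  positivity of the Hermitian part.
\<close>

section \<open>Adjoints, inner products and quadratic forms\<close>

lemma mat_adjoint_dim [simp]:
  "dim_row (mat_adjoint A) = dim_col A" "dim_col (mat_adjoint A) = dim_row A"
  by (auto simp: mat_adjoint_def)

lemma mat_adjoint_carrier [simp]:
  "A \<in> carrier_mat n m \<Longrightarrow> mat_adjoint A \<in> carrier_mat m n"
  by auto

lemma mat_adjoint_index [simp]:
  "i < dim_col A \<Longrightarrow> j < dim_row A \<Longrightarrow> mat_adjoint A $$ (i, j) = conjugate (A $$ (j, i))"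
  by (auto simp: mat_adjoint_def mat_of_rows_index)

lemma mult_mat_vec_index_sum:
  assumes "A \<in> carrier_mat n m" "x \<in> carrier_vec m" "i < n"
  shows "(A *\<^sub>v x) $ i = (\<Sum>j<m. A $$ (i, j) * x $ j)"
  using assms by (auto simp: scalar_prod_def atLeast0LessThan)

lemma cscalar_prod_sum:
  fixes x y :: "complex vec"
  assumes "y \<in> carrier_vec n"
  shows "x \<bullet>c y = (\<Sum>j<n. x $ j * cnj (y $ j))"
  using assms by (auto simp: scalar_prod_def atLeast0LessThan)

lemma mat_adjoint_cscalar_prod:
  fixes A :: "complex mat"
  assumes A: "A \<in> carrier_mat n m" and x: "x \<in> carrier_vec n" and y: "y \<in> carrier_vec m"
  shows "(mat_adjoint A *\<^sub>v x) \<bullet>c y = x \<bullet>c (A *\<^sub>v y)"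
proof -
  have "(mat_adjoint A *\<^sub>v x) \<bullet>c y
      = (\<Sum>j<m. (\<Sum>i<n. cnj (A $$ (i, j)) * x $ i) * cnj (y $ j))"
    unfolding cscalar_prod_sum[OF y]
    by (intro sum.cong refl arg_cong2[where f = "(*)"] trans[OF mult_mat_vec_index_sum[OF mat_adjoint_carrier[OF A] x]])
       (use A in auto)
  also have "\<dots> = (\<Sum>i<n. \<Sum>j<m. cnj (A $$ (i, j)) * x $ i * cnj (y $ j))"
    unfolding sum_distrib_right by (rule sum.swap)
  also have "\<dots> = (\<Sum>i<n. x $ i * cnj (\<Sum>j<m. A $$ (i, j) * y $ j))"
    by (simp add: sum_distrib_left mult_ac)
  also have "\<dots> = x \<bullet>c (A *\<^sub>v y)"
  proof -
    have "A *\<^sub>v y \<in> carrier_vec n" using A y by simp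
    then show ?thesis
      by (simp add: cscalar_prod_sum mult_mat_vec_index_sum[OF A y] del: index_mult_mat_vec cnj_sum)
  qed
  finally show ?thesis .
qed

text \<open>The adjoint contributes the conjugate value, so averaging leaves the real part.\<close>

lemma herm_part_quadratic_form:
  assumes A: "A \<in> carrier_mat n n" and x: "x \<in> carrier_vec n"
  shows "(herm_part A *\<^sub>v x) \<bullet>c x = of_real (Re ((A *\<^sub>v x) \<bullet>c x))"
proof -
  have Ax: "A *\<^sub>v x \<in> carrier_vec n" and A': "mat_adjoint A \<in> carrier_mat n n"
    using A x by auto
  then have A'x: "mat_adjoint A *\<^sub>v x \<in> carrier_vec n" using x by (rule_tac mult_mat_vec_carrier)
  have "herm_part A *\<^sub>v x = (1 / 2) \<cdot>\<^sub>v (A *\<^sub>v x + mat_adjoint A *\<^sub>v x)"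
  proof (rule eq_vecI)
    fix i assume i: "i < dim_vec ((1 / 2) \<cdot>\<^sub>v (A *\<^sub>v x + mat_adjoint A *\<^sub>v x))"
    then have "i < n" using A by simp
    then show "(herm_part A *\<^sub>v x) $ i = ((1 / 2) \<cdot>\<^sub>v (A *\<^sub>v x + mat_adjoint A *\<^sub>v x)) $ i"
      using A A' x by (simp add: herm_part_def add_scalar_prod_distrib[of _ n])
  qed (use A in \<open>simp add: herm_part_def\<close>)
  then have "(herm_part A *\<^sub>v x) \<bullet>c x = (1 / 2) * ((A *\<^sub>v x) \<bullet>c x + (mat_adjoint A *\<^sub>v x) \<bullet>c x)"
  proof -
    have "((1 / 2) \<cdot>\<^sub>v (u + v)) \<bullet>c x = (1 / 2) * (u \<bullet>c x + v \<bullet>c x)"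
      if "u \<in> carrier_vec n" "v \<in> carrier_vec n" for u v :: "complex vec"
      using that x by (simp add: add_scalar_prod_distrib[of _ n])
    then show ?thesis using \<open>herm_part A *\<^sub>v x = _\<close> Ax A'x by simp
  qed
  also have "(mat_adjoint A *\<^sub>v x) \<bullet>c x = cnj ((A *\<^sub>v x) \<bullet>c x)"
    by (simp add: mat_adjoint_cscalar_prod[OF A x x])
       (simp add: cscalar_prod_sum[OF x] cscalar_prod_sum[OF Ax] mult.commute)
  also have "(1 / 2) * ((A *\<^sub>v x) \<bullet>c x + cnj ((A *\<^sub>v x) \<bullet>c x)) = of_real (Re ((A *\<^sub>v x) \<bullet>c x))"
    by (simp add: complex_eq_iff)
  finally show ?thesis .
qed

lemma diag_cis_carrier [simp]: "diag_cis n \<phi> \<in> carrier_mat n n"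
  by (simp add: diag_cis_def)

lemma diag_cis_dim [simp]: "dim_row (diag_cis n \<phi>) = n" "dim_col (diag_cis n \<phi>) = n"
  using diag_cis_carrier[of n \<phi>] by (auto simp del: diag_cis_carrier)

lemma diag_cis_mult_vec_index:
  assumes "x \<in> carrier_vec n" "i < n"
  shows "(diag_cis n \<phi> *\<^sub>v x) $ i = cis (\<phi> (Suc i)) * x $ i"
proof -
  have "(\<Sum>j<n. diag_cis n \<phi> $$ (i, j) * x $ j) = (\<Sum>j<n. if i = j then cis (\<phi> (Suc i)) * x $ i else 0)"
    using assms by (intro sum.cong) (auto simp: diag_cis_def mat_diag_def)
  then show ?thesis using assms by (simp add: mult_mat_vec_index_sum[of _ n n] del: index_mult_mat_vec)
qed

lemma cnj_mult_self: "z * cnj z = of_real ((cmod z)\<^sup>2)"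
  using complex_norm_square[of z] by simp

text \<open>Moving \<open>mat_adjoint T\<close> across the inner product leaves the quadratic form
  of a diagonal matrix at \<open>T *\<^sub>v x\<close>.\<close>

lemma congruent_diag_cis_quadratic_form:
  assumes T: "T \<in> carrier_mat n n" and x: "x \<in> carrier_vec n"
  shows "((mat_adjoint T * diag_cis n \<phi> * T) *\<^sub>v x) \<bullet>c x =
    (\<Sum>i<n. cis (\<phi> (Suc i)) * of_real ((cmod ((T *\<^sub>v x) $ i))\<^sup>2))"
proof -
  have Tx: "T *\<^sub>v x \<in> carrier_vec n" using T x by simp
  have T': "mat_adjoint T \<in> carrier_mat n n" using T by simp
  have "(mat_adjoint T * diag_cis n \<phi> * T) *\<^sub>v x = (mat_adjoint T * diag_cis n \<phi>) *\<^sub>v (T *\<^sub>v x)"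
    by (rule assoc_mult_mat_vec[OF _ T x, of _ n]) (use T' in \<open>simp add: mult_carrier_mat[OF T']\<close>)
  also have "\<dots> = mat_adjoint T *\<^sub>v (diag_cis n \<phi> *\<^sub>v (T *\<^sub>v x))"
    by (rule assoc_mult_mat_vec[OF T' diag_cis_carrier Tx])
  finally have "((mat_adjoint T * diag_cis n \<phi> * T) *\<^sub>v x) \<bullet>c x
      = (diag_cis n \<phi> *\<^sub>v (T *\<^sub>v x)) \<bullet>c (T *\<^sub>v x)"
    using mat_adjoint_cscalar_prod[OF T _ x] mult_mat_vec_carrier[OF diag_cis_carrier Tx] by simp
  also have "\<dots> = (\<Sum>i<n. cis (\<phi> (Suc i)) * of_real ((cmod ((T *\<^sub>v x) $ i))\<^sup>2))"
    unfolding cscalar_prod_sum[OF Tx]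
    by (intro sum.cong refl)
       (simp only: diag_cis_mult_vec_index[OF Tx] cnj_mult_self mult.assoc lessThan_iff)
  finally show ?thesis .
qed

section \<open>Phases and the cone that contains the quadratic form\<close>

lemma invertible_matE:
  fixes T :: "'a :: field mat"
  assumes "T \<in> carrier_mat n n" "invertible_mat T"
  obtains S where "S \<in> carrier_mat n n" "S * T = 1\<^sub>m n" "T * S = 1\<^sub>m n"
proof -
  obtain S where S: "inverts_mat T S" "inverts_mat S T" using assms by (auto simp: invertible_mat_def)
  have TS: "T * S = 1\<^sub>m n" using S(1) assms by (simp add: inverts_mat_def)
  have ST: "S * T = 1\<^sub>m (dim_row S)" using S(2) by (simp add: inverts_mat_def)
  have "dim_col S = n" using arg_cong[OF TS, of dim_col] by simp
  moreover have "dim_row S = n" using arg_cong[OF ST, of dim_col] assms by simp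
  ultimately show ?thesis using that[of S] TS ST by auto
qed

text \<open>The weights are the squared moduli of the coordinates of \<open>T *\<^sub>v x\<close>;
  invertibility of \<open>T\<close> keeps one of them positive.\<close>

lemma phases_quadratic_formE:
  assumes A: "A \<in> carrier_mat n n" and ph: "phases A \<phi>"
    and x: "x \<in> carrier_vec n" "x \<noteq> 0\<^sub>v n"
  obtains w where "(A *\<^sub>v x) \<bullet>c x = (\<Sum>i<n. cis (\<phi> (Suc i)) * of_real (w i))"
    "\<And>i. w i \<ge> 0" "\<exists>i<n. w i > 0"
proof -
  obtain T where T: "T \<in> carrier_mat n n" "invertible_mat T" "A = mat_adjoint T * diag_cis n \<phi> * T"
    using ph A by (auto simp: phases_def Let_def)
  obtain S where S: "S \<in> carrier_mat n n" "S * T = 1\<^sub>m n" using invertible_matE[OF T(1,2)] by metis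
  have Tx: "T *\<^sub>v x \<in> carrier_vec n" using T x by simp
  have "T *\<^sub>v x \<noteq> 0\<^sub>v n"
  proof
    assume "T *\<^sub>v x = 0\<^sub>v n"
    then have "(S * T) *\<^sub>v x = 0\<^sub>v n"
      using S(1) T(1) x assoc_mult_mat_vec[OF S(1) T(1) x(1)] by (auto intro: eq_vecI)
    then show False using S(2) x by simp
  qed
  then obtain i where "i < n" "(T *\<^sub>v x) $ i \<noteq> 0"
    using Tx eq_vecI[of "0\<^sub>v n" "T *\<^sub>v x"] by (metis carrier_vecD index_zero_vec(1,2))
  then show ?thesis
    using that[of "\<lambda>i. (cmod ((T *\<^sub>v x) $ i))\<^sup>2"] congruent_diag_cis_quadratic_form[OF T(1) x(1)] T(3)
    by (auto simp del: index_mult_mat_vec)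
qed

text \<open>The preimage under \<open>T\<close> of the first unit vector isolates the first
  phase.\<close>

lemma phases_first_attained:
  assumes A: "A \<in> carrier_mat n n" and ph: "phases A \<phi>" and n: "0 < n"
  obtains x where "x \<in> carrier_vec n" "x \<noteq> 0\<^sub>v n" "(A *\<^sub>v x) \<bullet>c x = cis (\<phi> 1)"
proof -
  obtain T where T: "T \<in> carrier_mat n n" "invertible_mat T" "A = mat_adjoint T * diag_cis n \<phi> * T"
    using ph A by (auto simp: phases_def Let_def)
  obtain S where S: "S \<in> carrier_mat n n" "T * S = 1\<^sub>m n" using invertible_matE[OF T(1,2)] by metis
  define x where "x = S *\<^sub>v unit_vec n 0"
  have x: "x \<in> carrier_vec n" using S by (simp add: x_def)
  have Tx: "T *\<^sub>v x = unit_vec n 0"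
    unfolding x_def using assoc_mult_mat_vec[OF T(1) S(1), of "unit_vec n 0"] S(2) by simp
  have "(A *\<^sub>v x) \<bullet>c x = (\<Sum>i<n. if i = 0 then cis (\<phi> 1) else 0)"
    unfolding T(3) congruent_diag_cis_quadratic_form[OF T(1) x] Tx
    by (intro sum.cong) auto
  then have *: "(A *\<^sub>v x) \<bullet>c x = cis (\<phi> 1)" using n by simp
  have "(A *\<^sub>v 0\<^sub>v n) \<bullet>c 0\<^sub>v n = 0" using A by (simp add: cscalar_prod_sum)
  then have "x \<noteq> 0\<^sub>v n" using * by auto
  then show ?thesis using that x * by blast
qed

lemma phases_spread:
  assumes "A \<in> carrier_mat n n" "phases A \<phi>" "i < n"
  shows "\<phi> (Suc i) \<le> \<phi> 1" "\<phi> n \<le> \<phi> (Suc i)" "\<phi> 1 - pi < \<phi> (Suc i)"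
proof -
  have mono: "antimono_on {1..n} \<phi>" and less: "\<phi> 1 - \<phi> n < pi"
    using assms by (auto simp: phases_def Let_def)
  show "\<phi> (Suc i) \<le> \<phi> 1" "\<phi> n \<le> \<phi> (Suc i)"
    using monotone_onD[OF mono, of 1 "Suc i"] monotone_onD[OF mono, of "Suc i" n] assms(3) by auto
  then show "\<phi> 1 - pi < \<phi> (Suc i)" using less by linarith
qed

text \<open>The sign of the left side tells on which side of the line through 0 and
  \<open>cis \<theta>\<close> the sum lies, so cone arguments reduce to signs of sines.\<close>

lemma Im_rotated_sum:
  "Im (cis (- \<theta>) * (\<Sum>i<n. cis (\<phi> i) * of_real (w i))) = (\<Sum>i<n. sin (\<phi> i - \<theta>) * w i)"
proof -
  have "cis (- \<theta>) * (\<Sum>i<n. cis (\<phi> i) * of_real (w i)) = (\<Sum>i<n. cis (\<phi> i - \<theta>) * of_real (w i))"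
    by (simp add: sum_distrib_left mult.assoc[symmetric] cis_mult add.commute)
  then show ?thesis by (simp add: Im_sum)
qed

text \<open>All phases lie in the half-open interval from \<open>\<phi> 1 - pi\<close> to
  \<open>\<phi> 1\<close>, so every sine in the rotated sum is nonpositive.\<close>

lemma phases_Im_le:
  assumes A: "A \<in> carrier_mat n n" "phases A \<phi>" and x: "x \<in> carrier_vec n" "x \<noteq> 0\<^sub>v n"
  shows "Im (cis (- \<phi> 1) * ((A *\<^sub>v x) \<bullet>c x)) \<le> 0"
proof -
  obtain w where w: "(A *\<^sub>v x) \<bullet>c x = (\<Sum>i<n. cis (\<phi> (Suc i)) * of_real (w i))" "\<And>i. w i \<ge> 0"
    using phases_quadratic_formE[OF A x] by metis
  have "sin (\<phi> (Suc i) - \<phi> 1) \<le> 0" if "i < n" for i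
    using phases_spread[OF A that] sin_ge_zero[of "\<phi> 1 - \<phi> (Suc i)"] sin_minus[of "\<phi> 1 - \<phi> (Suc i)"] by auto
  then show ?thesis
    unfolding w(1) Im_rotated_sum by (intro sum_nonpos mult_nonpos_nonneg) (auto simp: w(2))
qed

lemma phases_Im_less:
  assumes A: "A \<in> carrier_mat n n" "phases A \<phi>" and x: "x \<in> carrier_vec n" "x \<noteq> 0\<^sub>v n"
    and \<theta>: "\<bar>\<phi> 1\<bar> < \<theta>" "\<bar>\<phi> n\<bar> < \<theta>" "\<theta> \<le> pi / 2"
  shows "Im (cis (- \<theta>) * ((A *\<^sub>v x) \<bullet>c x)) < 0"
proof -
  obtain w where w: "(A *\<^sub>v x) \<bullet>c x = (\<Sum>i<n. cis (\<phi> (Suc i)) * of_real (w i))"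
    "\<And>i. w i \<ge> 0" "\<exists>i<n. w i > 0"
    using phases_quadratic_formE[OF A x] by metis
  \<comment> \<open>Every phase lies strictly between \<open>- \<theta>\<close> and
    \<open>\<theta>\<close>, and \<open>2 * \<theta> \<le> pi\<close>, so the difference lies
    strictly between \<open>- pi\<close> and 0.\<close>
  have neg: "sin (\<phi> (Suc i) - \<theta>) < 0" if "i < n" for i
    using phases_spread[OF A that] \<theta> sin_gt_zero[of "\<theta> - \<phi> (Suc i)"] sin_minus[of "\<theta> - \<phi> (Suc i)"]
    by auto
  then have pos: "0 \<le> - (sin (\<phi> (Suc i) - \<theta>) * w i)" if "i < n" for i
    using that w(2)[of i] by (simp add: mult_nonpos_nonneg less_imp_le)
  obtain i where i: "i < n" "w i > 0" using w(3) by auto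
  have "0 < (\<Sum>i<n. - (sin (\<phi> (Suc i) - \<theta>) * w i))"
    by (rule sum_pos2[of _ i]) (use i neg[OF i(1)] pos in \<open>auto simp: mult_neg_pos\<close>)
  then show ?thesis unfolding w(1) Im_rotated_sum by (simp add: sum_negf)
qed

section \<open>Singularity as an equation for one vector\<close>

lemma det_one_plus_diag_cis_mult_eq_0_iff:
  assumes D: "D \<in> carrier_mat n n"
  shows "det (1\<^sub>m n + diag_cis n \<mu> * D) = 0 \<longleftrightarrow>
    (\<exists>x \<in> carrier_vec n. x \<noteq> 0\<^sub>v n \<and> (\<forall>i<n. (D *\<^sub>v x) $ i = cis (pi - \<mu> (Suc i)) * x $ i))"
proof -
  have MD: "diag_cis n \<mu> * D \<in> carrier_mat n n" using mult_carrier_mat[OF diag_cis_carrier D] .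
  have "(1\<^sub>m n + diag_cis n \<mu> * D) *\<^sub>v x = 0\<^sub>v n \<longleftrightarrow> (\<forall>i<n. (D *\<^sub>v x) $ i = cis (pi - \<mu> (Suc i)) * x $ i)"
    if x: "x \<in> carrier_vec n" for x
  proof -
    have Dx: "D *\<^sub>v x \<in> carrier_vec n" using D x by simp
    have "(1\<^sub>m n + diag_cis n \<mu> * D) *\<^sub>v x = x + diag_cis n \<mu> *\<^sub>v (D *\<^sub>v x)"
      using add_mult_distrib_mat_vec[OF one_carrier_mat MD x] assoc_mult_mat_vec[OF diag_cis_carrier D x] x
      by simp
    then have "(1\<^sub>m n + diag_cis n \<mu> * D) *\<^sub>v x = 0\<^sub>v n \<longleftrightarrow> x + diag_cis n \<mu> *\<^sub>v (D *\<^sub>v x) = 0\<^sub>v n"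
      by simp
    also have "\<dots> \<longleftrightarrow> (\<forall>i<n. (x + diag_cis n \<mu> *\<^sub>v (D *\<^sub>v x)) $ i = 0)"
      using add_carrier_vec[OF x mult_mat_vec_carrier[OF diag_cis_carrier[of n \<mu>] Dx]]
      by (auto simp: vec_eq_iff simp del: index_mult_mat_vec index_add_vec)
    also have "\<dots> \<longleftrightarrow> (\<forall>i<n. x $ i + cis (\<mu> (Suc i)) * (D *\<^sub>v x) $ i = 0)"
      using x mult_mat_vec_carrier[OF diag_cis_carrier[of n \<mu>] Dx]
      by (simp add: diag_cis_mult_vec_index[OF Dx] del: index_mult_mat_vec)
    also have "\<dots> \<longleftrightarrow> (\<forall>i<n. (D *\<^sub>v x) $ i = cis (pi - \<mu> (Suc i)) * x $ i)"
    proof -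
      have "x' + cis m * y = 0 \<longleftrightarrow> y = cis (pi - m) * x'" for x' y m
      proof -
        \<comment> \<open>Minus the inverse of \<open>cis m\<close> is \<open>cis (pi - m)\<close>,
          which is where the angles \<open>pi - \<mu> (Suc i)\<close> come from.\<close>
        have "cis m * cis (pi - m) = -1" by (simp add: cis_mult)
        then have "cis m * (y - cis (pi - m) * x') = x' + cis m * y"
          by (simp add: right_diff_distrib mult.assoc[symmetric])
        then show ?thesis by (metis cis_neq_zero eq_iff_diff_eq_0 mult_eq_0_iff)
      qed
      then show ?thesis by (simp del: index_mult_mat_vec)
    qed
    finally show ?thesis .
  qed
  then show ?thesis using det_0_iff_vec_prod_zero[of "1\<^sub>m n + diag_cis n \<mu> * D" n] MD by auto
qed

section \<open>Test vectors for real matrices and the extremal inequality\<close>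

text \<open>A real matrix commutes with conjugation, so its action on \<open>x\<close> determines
  its action on the span of \<open>x\<close> and its conjugate.\<close>

lemma real_mat_pencil:
  fixes R :: "real mat" and e :: "nat \<Rightarrow> complex" and a b :: real
  assumes R: "R \<in> carrier_mat n n" and x: "x \<in> carrier_vec n" "x \<noteq> 0\<^sub>v n"
    and eig: "\<And>i. i < n \<Longrightarrow> (map_mat complex_of_real R *\<^sub>v x) $ i = e i * x $ i"
    and ab: "0 \<le> b" "0 \<le> a"
  defines "c \<equiv> (\<Sum>i<n. e i * of_real ((cmod (x $ i))\<^sup>2))" and "q \<equiv> (\<Sum>i<n. e i * (x $ i)\<^sup>2)"
  obtains y where "y \<in> carrier_vec n" "b < a \<Longrightarrow> y \<noteq> 0\<^sub>v n"
    "(map_mat complex_of_real R *\<^sub>v y) \<bullet>c y =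
       Complex ((a\<^sup>2 + b\<^sup>2) * Re c - 2 * a * b * cmod q) ((a\<^sup>2 - b\<^sup>2) * Im c)"
proof -
  \<comment> \<open>The argument is opposite to that of \<open>q\<close>, so the cross terms,
    \<open>2 * a\<close> times the real part of \<open>cnj \<beta> * q\<close>, become
    \<open>- 2 * a * b * cmod q\<close>.\<close>
  define \<beta> where "\<beta> = - of_real b * cis (Arg q)"
  define y where "y = vec n (\<lambda>i. of_real a * x $ i + \<beta> * cnj (x $ i))"
  have y: "y \<in> carrier_vec n" by (simp add: y_def)
  have C: "map_mat complex_of_real R \<in> carrier_mat n n" using R by simp
  have Ry: "(map_mat complex_of_real R *\<^sub>v y) $ i = of_real a * (e i * x $ i) + \<beta> * cnj (e i * x $ i)"
    if i: "i < n" for i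
  proof -
    have "(map_mat complex_of_real R *\<^sub>v y) $ i = (\<Sum>j<n. of_real (R $$ (i, j)) * y $ j)"
      using R i by (simp add: mult_mat_vec_index_sum[OF C y i] del: index_mult_mat_vec)
    also have "\<dots> = of_real a * (\<Sum>j<n. of_real (R $$ (i, j)) * x $ j)
        + \<beta> * cnj (\<Sum>j<n. of_real (R $$ (i, j)) * x $ j)"
      by (simp add: y_def sum_distrib_left sum.distrib distrib_left mult.left_commute)
    also have "(\<Sum>j<n. of_real (R $$ (i, j)) * x $ j) = e i * x $ i"
      using R i eig[OF i] by (simp add: mult_mat_vec_index_sum[OF C x(1) i] del: index_mult_mat_vec)
    finally show ?thesis .
  qed
  have \<beta>q: "cnj \<beta> * q = - of_real (b * cmod q)"
  proof -
    have "cnj (cis (Arg q)) * q = of_real (cmod q)"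
      using arg_cong[OF rcis_cmod_Arg[of q], of "(*) (cnj (cis (Arg q)))"]
      by (simp add: rcis_def cis_cnj mult.left_commute cis_mult)
    then show ?thesis by (simp add: \<beta>_def mult.assoc)
  qed
  have \<beta>\<beta>: "\<beta> * cnj \<beta> = of_real (b\<^sup>2)"
    unfolding cnj_mult_self by (simp add: \<beta>_def norm_mult)
  have "(map_mat complex_of_real R *\<^sub>v y) \<bullet>c y
      = (\<Sum>i<n. (of_real a * (e i * x $ i) + \<beta> * cnj (e i * x $ i)) * cnj (of_real a * x $ i + \<beta> * cnj (x $ i)))"
    unfolding cscalar_prod_sum[OF y] using Ry by (intro sum.cong refl) (simp add: y_def del: index_mult_mat_vec)
  also have "\<dots> = (\<Sum>i<n. of_real (a\<^sup>2) * (e i * of_real ((cmod (x $ i))\<^sup>2))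
      + of_real (b\<^sup>2) * cnj (e i * of_real ((cmod (x $ i))\<^sup>2))
      + of_real a * (cnj \<beta> * (e i * (x $ i)\<^sup>2)) + of_real a * cnj (cnj \<beta> * (e i * (x $ i)\<^sup>2)))"
    by (intro sum.cong refl)
       (simp only: cnj_mult_self[symmetric] \<beta>\<beta>[symmetric],
        simp add: algebra_simps power2_eq_square)
  also have "\<dots> = of_real (a\<^sup>2) * c + of_real (b\<^sup>2) * cnj c
      + of_real a * (cnj \<beta> * q) + of_real a * cnj (cnj \<beta> * q)"
    by (simp only: sum.distrib sum_distrib_left[symmetric] cnj_sum[symmetric] c_def q_def)
  also have "\<dots> = Complex ((a\<^sup>2 + b\<^sup>2) * Re c - 2 * a * b * cmod q) ((a\<^sup>2 - b\<^sup>2) * Im c)"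
    unfolding \<beta>q by (simp add: complex_eq_iff algebra_simps)
  finally have 1: "(map_mat complex_of_real R *\<^sub>v y) \<bullet>c y = \<dots>" .
  \<comment> \<open>Where \<open>x $ i\<close> is nonzero, the two summands of \<open>y $ i\<close>
    have different moduli and cannot cancel.\<close>
  have 2: "y \<noteq> 0\<^sub>v n" if "b < a"
  proof
    assume "y = 0\<^sub>v n"
    obtain i where i: "i < n" "x $ i \<noteq> 0" using x by (metis carrier_vecD eq_vecI index_zero_vec)
    have "of_real a * x $ i + \<beta> * cnj (x $ i) = 0"
      using arg_cong[OF \<open>y = 0\<^sub>v n\<close>, of "\<lambda>v. v $ i"] i by (simp add: y_def)
    then have "cmod (of_real a * x $ i) = cmod (\<beta> * cnj (x $ i))"
      by (metis add_eq_0_iff norm_minus_cancel)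
    then show False using i ab that by (simp add: norm_mult \<beta>_def)
  qed
  show ?thesis using that[OF y 2 1] .
qed

text \<open>Rotating \<open>c\<close> by \<open>- s\<close> gives term 0 the coefficient
  \<open>- sin d\<close> and every later term a coefficient at least \<open>sin d\<close>. The
  resulting lower bound is compared with \<open>cmod q\<close> by the triangle inequality.\<close>

lemma extremal_sum_ineq:
  fixes x :: "nat \<Rightarrow> complex" and \<psi> :: "nat \<Rightarrow> real"
  assumes d: "0 \<le> d" "d \<le> pi" and \<psi>0: "\<psi> 0 = s - d"
    and \<psi>: "\<And>i. i < m \<Longrightarrow> s + d \<le> \<psi> (Suc i)" "\<And>i. i < m \<Longrightarrow> \<psi> (Suc i) \<le> \<psi> 0 + pi"
  defines "c \<equiv> (\<Sum>i<Suc m. cis (\<psi> i) * of_real ((cmod (x i))\<^sup>2))"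
    and "q \<equiv> (\<Sum>i<Suc m. cis (\<psi> i) * (x i)\<^sup>2)"
  shows "sin s * Re c - sin d * cmod q \<le> cos s * Im c"
proof -
  define p where "p i = (cmod (x i))\<^sup>2" for i
  have p: "p i \<ge> 0" for i by (simp add: p_def)
  have "p 0 = cmod (cis (\<psi> 0) * (x 0)\<^sup>2)" by (simp add: p_def norm_mult norm_power)
  also have "\<dots> = cmod (q - (\<Sum>i<m. cis (\<psi> (Suc i)) * (x (Suc i))\<^sup>2))"
    unfolding q_def by (subst sum.lessThan_Suc_shift) simp
  also have "\<dots> \<le> cmod q + cmod (\<Sum>i<m. cis (\<psi> (Suc i)) * (x (Suc i))\<^sup>2)" by (rule norm_triangle_ineq4)
  also have "cmod (\<Sum>i<m. cis (\<psi> (Suc i)) * (x (Suc i))\<^sup>2) \<le> (\<Sum>i<m. p (Suc i))"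
    by (rule sum_norm_le) (simp add: norm_mult norm_power p_def)
  finally have q: "p 0 - (\<Sum>i<m. p (Suc i)) \<le> cmod q" by simp
  have "cos s * Im c - sin s * Re c = Im (cis (- s) * c)" by (simp add: algebra_simps)
  also have "\<dots> = (\<Sum>i<Suc m. sin (\<psi> i - s) * p i)" unfolding c_def Im_rotated_sum p_def ..
  also have "\<dots> = - sin d * p 0 + (\<Sum>i<m. sin (\<psi> (Suc i) - s) * p (Suc i))"
    by (subst sum.lessThan_Suc_shift) (simp add: \<psi>0)
  finally have c: "cos s * Im c - sin s * Re c = \<dots>" .
  have "sin d \<le> sin (\<psi> (Suc i) - s)" if "i < m" for i
  proof -
    define t where "t = \<psi> (Suc i) - s"
    \<comment> \<open>On this interval, symmetric about \<open>pi / 2\<close>, the sine is smallest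
      at the endpoints; the sum-to-product formula shows it.\<close>
    have t: "d \<le> t" "t \<le> pi - d" using \<psi>[OF that] \<psi>0 by (auto simp: t_def)
    have "sin t - sin d = 2 * sin ((t - d) / 2) * cos ((t + d) / 2)" by (rule sin_diff_sin)
    moreover have "0 \<le> sin ((t - d) / 2)" using t d by (intro sin_ge_zero) auto
    moreover have "0 \<le> cos ((t + d) / 2)" using t d by (intro cos_ge_zero) auto
    ultimately have "0 \<le> sin t - sin d" by simp
    then show ?thesis by (simp add: t_def)
  qed
  then have "sin d * (\<Sum>i<m. p (Suc i)) \<le> (\<Sum>i<m. sin (\<psi> (Suc i) - s) * p (Suc i))"
    unfolding sum_distrib_left by (intro sum_mono mult_right_mono p) auto
  moreover have "sin d * (p 0 - (\<Sum>i<m. p (Suc i))) \<le> sin d * cmod q"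
    using d by (intro mult_left_mono q sin_ge_zero) auto
  ultimately show ?thesis using c by (simp add: algebra_simps)
qed

section \<open>The complex radius\<close>

lemma diag_cis_phases:
  assumes "antimono_on {1..n} \<phi>" "\<phi> 1 - \<phi> n < pi" "- pi < (\<phi> 1 + \<phi> n) / 2" "(\<phi> 1 + \<phi> n) / 2 \<le> pi"
  shows "phases (diag_cis n \<phi>) \<phi>"
proof -
  have "mat_adjoint (1\<^sub>m n :: complex mat) = 1\<^sub>m n" by (rule eq_matI) auto
  then have "diag_cis n \<phi> = mat_adjoint (1\<^sub>m n) * diag_cis n \<phi> * 1\<^sub>m n"
    by (simp add: left_mult_one_mat[OF diag_cis_carrier] right_mult_one_mat[OF diag_cis_carrier])
  moreover have "invertible_mat (1\<^sub>m n :: complex mat)"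
    by (auto simp: invertible_mat_def inverts_mat_def intro!: exI[of _ "1\<^sub>m n"])
  ultimately show ?thesis using assms one_carrier_mat unfolding phases_def Let_def diag_cis_dim by metis
qed

lemma diag_cis_const_sectorial: "sectorial (diag_cis n (\<lambda>_. \<theta>))"
proof -
  have "(diag_cis n (\<lambda>_. \<theta>) *\<^sub>v x) \<bullet>c x = cis \<theta> * (x \<bullet>c x)" if x: "x \<in> carrier_vec n" for x
    unfolding cscalar_prod_sum[OF x] sum_distrib_left
    by (intro sum.cong refl) (simp add: diag_cis_mult_vec_index[OF x] del: index_mult_mat_vec)
  then show ?thesis by (auto simp: sectorial_def numerical_range_def)
qed

lemma theta_complex_diag_cis:
  assumes n: "0 < n" and mono: "antimono_on {1..n} \<mu>" and spread: "\<mu> 1 - \<mu> n < pi"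
    and \<mu>1: "pi / 2 \<le> \<mu> 1" "\<mu> 1 < pi"
  shows "theta_complex (diag_cis n \<mu>) = ereal (pi - \<mu> 1)"
proof -
  show ?thesis unfolding theta_complex_def Let_def diag_cis_dim
  proof (rule antisym)
    show "Inf {ereal (max \<bar>\<phi> 1\<bar> \<bar>\<phi> n\<bar>) |D \<phi>. D \<in> carrier_mat n n \<and> sectorial D \<and> phases D \<phi> \<and>
        det (1\<^sub>m n + diag_cis n \<mu> * D) = 0} \<le> ereal (pi - \<mu> 1)"
    proof (rule Inf_lower, safe)
      \<comment> \<open>A scalar matrix satisfies the singularity equation at the first unit vector,
        and all its phases equal the claimed radius.\<close>
      let ?D = "diag_cis n (\<lambda>_. pi - \<mu> 1)"
      have "det (1\<^sub>m n + diag_cis n \<mu> * ?D) = 0"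
        unfolding det_one_plus_diag_cis_mult_eq_0_iff[OF diag_cis_carrier]
        by (rule bexI[of _ "unit_vec n 0"])
           (use n in \<open>auto simp: diag_cis_mult_vec_index[OF unit_vec_carrier] simp del: index_mult_mat_vec\<close>)
      moreover have "phases ?D (\<lambda>_. pi - \<mu> 1)"
        by (rule diag_cis_phases) (use \<mu>1 in \<open>auto intro: monotone_onI\<close>)
      moreover have "max \<bar>pi - \<mu> 1\<bar> \<bar>pi - \<mu> 1\<bar> = pi - \<mu> 1" using \<mu>1 by simp
      ultimately show "\<exists>D \<phi>. ereal (pi - \<mu> 1) = ereal (max \<bar>\<phi> 1\<bar> \<bar>\<phi> n\<bar>) \<and> D \<in> carrier_mat n n \<and>
          sectorial D \<and> phases D \<phi> \<and> det (1\<^sub>m n + diag_cis n \<mu> * D) = 0"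
        using diag_cis_const_sectorial diag_cis_carrier by metis
    qed
  next
    show "ereal (pi - \<mu> 1) \<le> Inf {ereal (max \<bar>\<phi> 1\<bar> \<bar>\<phi> n\<bar>) |D \<phi>. D \<in> carrier_mat n n \<and> sectorial D \<and>
        phases D \<phi> \<and> det (1\<^sub>m n + diag_cis n \<mu> * D) = 0}"
    proof (rule Inf_greatest, safe)
      fix D \<phi>
      assume D: "D \<in> carrier_mat n n" "phases D \<phi>" and "det (1\<^sub>m n + diag_cis n \<mu> * D) = 0"
      then obtain x where x: "x \<in> carrier_vec n" "x \<noteq> 0\<^sub>v n"
        and Dx: "\<And>i. i < n \<Longrightarrow> (D *\<^sub>v x) $ i = cis (pi - \<mu> (Suc i)) * x $ i"
        using det_one_plus_diag_cis_mult_eq_0_iff[OF D(1)] by blast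
      have "(D *\<^sub>v x) \<bullet>c x = (\<Sum>i<n. cis (pi - \<mu> (Suc i)) * of_real ((cmod (x $ i))\<^sup>2))"
        unfolding cscalar_prod_sum[OF x(1)]
        by (intro sum.cong refl) (simp only: Dx cnj_mult_self mult.assoc lessThan_iff)
      \<comment> \<open>The angle equals \<open>\<mu> 1 - \<mu> (Suc i)\<close>, which lies between
        0 and \<open>pi\<close>. Phases all smaller than \<open>pi - \<mu> 1\<close> in modulus
        would make the rotated value strictly negative instead.\<close>
      moreover have "0 \<le> sin (pi - \<mu> (Suc i) - (pi - \<mu> 1))" if "i < n" for i
        using monotone_onD[OF mono, of 1 "Suc i"] monotone_onD[OF mono, of "Suc i" n] that spread
        by (intro sin_ge_zero) auto
      ultimately have "0 \<le> Im (cis (- (pi - \<mu> 1)) * ((D *\<^sub>v x) \<bullet>c x))"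
        unfolding Im_rotated_sum[of "pi - \<mu> 1"] by (simp only: Im_rotated_sum) (intro sum_nonneg mult_nonneg_nonneg, auto)
      then have "\<not> (\<bar>\<phi> 1\<bar> < pi - \<mu> 1 \<and> \<bar>\<phi> n\<bar> < pi - \<mu> 1)"
        using phases_Im_less[OF D x, of "pi - \<mu> 1"] \<mu>1 by auto
      then have "pi - \<mu> 1 \<le> max \<bar>\<phi> 1\<bar> \<bar>\<phi> n\<bar>" by linarith
      then show "ereal (pi - \<mu> 1) \<le> ereal (max \<bar>\<phi> 1\<bar> \<bar>\<phi> n\<bar>)" by (simp only: ereal_less_eq)
    qed
  qed
qed

section \<open>Bounds for feasible real matrices\<close>

lemma pos_def_herm_part_iff:
  assumes A: "A \<in> carrier_mat n n"
  shows "pos_def (herm_part A) \<longleftrightarrow> (\<forall>x\<in>carrier_vec n. x \<noteq> 0\<^sub>v n \<longrightarrow> 0 < Re ((A *\<^sub>v x) \<bullet>c x))"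
proof -
  have "mat_adjoint (herm_part A) = herm_part A"
    by (rule eq_matI) (use A in \<open>auto simp: herm_part_def add.commute\<close>)
  moreover have "dim_row (herm_part A) = n" "square_mat (herm_part A)"
    using A by (auto simp: herm_part_def)
  ultimately show ?thesis
    by (auto simp: pos_def_def herm_part_quadratic_form[OF A] less_complex_def)
qed

text \<open>Positivity on the pencil forces \<open>cmod q \<le> Re c\<close>, whereas the extremal
  inequality bounds \<open>Re c\<close> by a factor below 1 times \<open>cmod q\<close>.\<close>

lemma real_mat_infeasible:
  fixes R :: "real mat"
  assumes R: "R \<in> carrier_mat (Suc m) (Suc m)" and x: "x \<in> carrier_vec (Suc m)" "x \<noteq> 0\<^sub>v (Suc m)"
    and pos: "\<And>y. y \<in> carrier_vec (Suc m) \<Longrightarrow> y \<noteq> 0\<^sub>v (Suc m) \<Longrightarrow>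
      0 < Re ((map_mat complex_of_real R *\<^sub>v y) \<bullet>c y)"
    and eig: "\<And>i. i < Suc m \<Longrightarrow> (map_mat complex_of_real R *\<^sub>v x) $ i = cis (\<psi> i) * x $ i"
    and \<psi>0: "0 < \<psi> 0" "\<psi> 0 < pi / 2"
    and \<psi>: "\<And>i. i < m \<Longrightarrow> pi - \<psi> 0 \<le> \<psi> (Suc i)" "\<And>i. i < m \<Longrightarrow> \<psi> (Suc i) \<le> \<psi> 0 + pi"
  shows False
proof -
  define c where "c = (\<Sum>i<Suc m. cis (\<psi> i) * of_real ((cmod (x $ i))\<^sup>2))"
  define q where "q = (\<Sum>i<Suc m. cis (\<psi> i) * (x $ i)\<^sup>2)"
  have "(map_mat complex_of_real R *\<^sub>v x) \<bullet>c x = c"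
    unfolding cscalar_prod_sum[OF x(1)] c_def
    by (intro sum.cong refl) (simp only: eig cnj_mult_self mult.assoc lessThan_iff)
  then have c: "0 < Re c" using pos[OF x] by simp
  \<comment> \<open>At \<open>a = b = 1\<close> the imaginary part vanishes, but \<open>y\<close>
    may be zero, so only a nonstrict inequality follows.\<close>
  obtain y where y: "y \<in> carrier_vec (Suc m)" "(map_mat complex_of_real R *\<^sub>v y) \<bullet>c y =
       Complex ((1\<^sup>2 + 1\<^sup>2) * Re c - 2 * 1 * 1 * cmod q) ((1\<^sup>2 - 1\<^sup>2) * Im c)"
    using real_mat_pencil[OF R x eig, of 1 1] unfolding c_def q_def by auto
  have "0 \<le> Re ((map_mat complex_of_real R *\<^sub>v y) \<bullet>c y)"
  proof (cases "y = 0\<^sub>v (Suc m)")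
    case True
    then show ?thesis unfolding cscalar_prod_sum[OF y(1)] by simp
  next
    case False
    then show ?thesis using pos[OF y(1)] by simp
  qed
  then have 1: "cmod q \<le> Re c" by (simp add: y(2))
  \<comment> \<open>The choices are \<open>s = pi / 2\<close> and
    \<open>d = pi / 2 - \<psi> 0\<close>, hence \<open>s + d = pi - \<psi> 0\<close> and
    \<open>sin d = cos (\<psi> 0)\<close>.\<close>
  have "sin (pi / 2) * Re c - sin (pi / 2 - \<psi> 0) * cmod q \<le> cos (pi / 2) * Im c"
    unfolding c_def q_def by (rule extremal_sum_ineq) (use \<psi>0 \<psi> in \<open>force+\<close>)
  then have 2: "Re c \<le> cos (\<psi> 0) * cmod q" by (simp add: sin_diff)
  have "cos (\<psi> 0) < 1" using cos_monotone_0_pi[of 0 "\<psi> 0"] \<psi>0 by simp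
  moreover have "0 < cos (\<psi> 0)" using \<psi>0 by (intro cos_gt_zero_pi) auto
  moreover have "0 < cmod q" using 2 c by (cases "q = 0") auto
  ultimately have "cos (\<psi> 0) * cmod q < cmod q" by simp
  then show False using 1 2 by simp
qed

lemma arccos_less_pi_half:
  assumes "0 < x" "x < (1 :: real)"
  shows "0 < arccos x" "arccos x < pi / 2" "cos (arccos x) = x"
proof -
  have "arccos x < arccos 0" using assms by (subst arccos_less_mono) auto
  then show "arccos x < pi / 2" by simp
qed (use assms arccos_lt_bounded[of x] in auto)

text \<open>The value at a suitable \<open>y\<close> is \<open>r + \<i> * k * Im c\<close> with
  \<open>0 < r \<le> cos s * Im c\<close>. The tangent of its argument is therefore at least
  \<open>k / cos s\<close>, the tangent of the claimed angle, and \<open>\<phi> 1\<close> bounds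
  that argument.\<close>

lemma real_mat_phase_ge:
  fixes R :: "real mat"
  assumes R: "R \<in> carrier_mat (Suc m) (Suc m)" and x: "x \<in> carrier_vec (Suc m)" "x \<noteq> 0\<^sub>v (Suc m)"
    and pos: "\<And>y. y \<in> carrier_vec (Suc m) \<Longrightarrow> y \<noteq> 0\<^sub>v (Suc m) \<Longrightarrow>
      0 < Re ((map_mat complex_of_real R *\<^sub>v y) \<bullet>c y)"
    and ph: "phases (map_mat complex_of_real R) \<phi>"
    and eig: "\<And>i. i < Suc m \<Longrightarrow> (map_mat complex_of_real R *\<^sub>v x) $ i = cis (\<psi> i) * x $ i"
    and d: "0 \<le> d" "d < s" "s < pi / 2" and \<psi>0: "\<psi> 0 = s - d"
    and \<psi>: "\<And>i. i < m \<Longrightarrow> s + d \<le> \<psi> (Suc i)" "\<And>i. i < m \<Longrightarrow> \<psi> (Suc i) \<le> \<psi> 0 + pi"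
  shows "arccos (cos s / cos d) \<le> \<phi> 1"
proof -
  let ?C = "map_mat complex_of_real R"
  have C: "?C \<in> carrier_mat (Suc m) (Suc m)" using R by simp
  define c where "c = (\<Sum>i<Suc m. cis (\<psi> i) * of_real ((cmod (x $ i))\<^sup>2))"
  define q where "q = (\<Sum>i<Suc m. cis (\<psi> i) * (x $ i)\<^sup>2)"
  \<comment> \<open>\<open>a\<close> and \<open>b\<close> are chosen so that \<open>a\<^sup>2 + b\<^sup>2 = sin s\<close>, \<open>2ab = sin d\<close> and \<open>a\<^sup>2 - b\<^sup>2 = k\<close>, which
    makes \<open>extremal_sum_ineq\<close> applicable to the value at \<open>y\<close>.\<close>
  define k where "k = sqrt ((cos d)\<^sup>2 - (cos s)\<^sup>2)"
  define a where "a = sqrt ((sin s + k) / 2)"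
  define b where "b = sqrt ((sin s - k) / 2)"
  have cs: "0 < cos s" "cos s < cos d" using d by (auto intro: cos_gt_zero_pi cos_monotone_0_pi)
  have sn: "0 \<le> sin d" "0 < sin s" using d by (auto intro: sin_ge_zero sin_gt_zero)
  have "(cos s)\<^sup>2 < (cos d)\<^sup>2" using cs by (intro power_strict_mono) auto
  then have k: "0 < k" "k\<^sup>2 = (cos d)\<^sup>2 - (cos s)\<^sup>2" by (auto simp: k_def)
  \<comment> \<open>This identity yields both \<open>k \<le> sin s\<close>, needed for the root
    defining \<open>b\<close>, and \<open>2 * a * b = sin d\<close>.\<close>
  have sk: "(sin s)\<^sup>2 - k\<^sup>2 = (sin d)\<^sup>2" unfolding k(2) by (simp add: cos_squared_eq)
  then have "k\<^sup>2 \<le> (sin s)\<^sup>2" by (metis diff_ge_0_iff_ge zero_le_power2)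
  then have ks: "k \<le> sin s" using sn by (auto intro: power2_le_imp_le[OF \<open>k\<^sup>2 \<le> (sin s)\<^sup>2\<close>])
  have a2: "a\<^sup>2 = (sin s + k) / 2" and b2: "b\<^sup>2 = (sin s - k) / 2" and ab0: "0 \<le> b" "0 \<le> a" and ba: "b < a"
    using k(1) ks by (auto simp: a_def b_def)
  have "(2 * a * b)\<^sup>2 = 4 * a\<^sup>2 * b\<^sup>2" by (simp add: power_mult_distrib)
  also have "\<dots> = (sin s + k) * (sin s - k)" unfolding a2 b2 by simp
  also have "\<dots> = (sin d)\<^sup>2" unfolding sk[symmetric] by (simp add: power2_eq_square algebra_simps)
  finally have "(2 * a * b)\<^sup>2 = (sin d)\<^sup>2" .
  then have ab: "2 * a * b = sin d" using ab0 sn by (simp add: power2_eq_iff_nonneg)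
  have sums: "a\<^sup>2 + b\<^sup>2 = sin s" "a\<^sup>2 - b\<^sup>2 = k" unfolding a2 b2 by (auto simp: field_simps)
  obtain y where y: "y \<in> carrier_vec (Suc m)" "y \<noteq> 0\<^sub>v (Suc m)"
    and Cy: "(?C *\<^sub>v y) \<bullet>c y = Complex (sin s * Re c - sin d * cmod q) (k * Im c)"
    using real_mat_pencil[OF R x eig ab0] ba unfolding c_def q_def sums ab by blast
  define r where "r = sin s * Re c - sin d * cmod q"
  have r: "0 < r" using pos[OF y] by (simp add: Cy r_def)
  have ext: "r \<le> cos s * Im c"
    unfolding r_def c_def q_def by (rule extremal_sum_ineq) (use d \<psi>0 \<psi> in \<open>force+\<close>)
  \<comment> \<open>The normalisation of phases alone only gives
    \<open>\<bar>\<phi> 1\<bar> < 3 * pi / 2\<close>; positivity of the value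
    \<open>cis (\<phi> 1)\<close> places \<open>\<phi> 1\<close> in the right half-plane.\<close>
  obtain z where "z \<in> carrier_vec (Suc m)" "z \<noteq> 0\<^sub>v (Suc m)" "(?C *\<^sub>v z) \<bullet>c z = cis (\<phi> 1)"
    using phases_first_attained[OF C ph] by blast
  then have "0 < cos (\<phi> 1)" using pos[of z] by simp
  moreover have "\<bar>\<phi> 1\<bar> < 3 * pi / 2"
    using ph phases_spread(1)[OF C ph, of m] C by (auto simp: phases_def Let_def)
  moreover have "cos (\<phi> 1) = - cos (\<bar>\<phi> 1\<bar> - pi)" by simp
  ultimately have \<phi>1: "0 < cos (\<phi> 1)" "\<bar>\<phi> 1\<bar> < pi / 2"
    using cos_ge_zero[of "\<bar>\<phi> 1\<bar> - pi"] by linarith+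
  have "k * Im c * cos (\<phi> 1) \<le> r * sin (\<phi> 1)"
    using phases_Im_le[OF C ph y] unfolding Cy r_def by (simp add: algebra_simps)
  then have "cos s * (k * Im c * cos (\<phi> 1)) \<le> cos s * (r * sin (\<phi> 1))"
    using cs by (intro mult_left_mono) auto
  moreover have "k * cos (\<phi> 1) * r \<le> k * cos (\<phi> 1) * (cos s * Im c)"
    using ext k \<phi>1 by (intro mult_left_mono) auto
  ultimately have "r * (k * cos (\<phi> 1)) \<le> r * (cos s * sin (\<phi> 1))" by (simp add: mult_ac)
  \<comment> \<open>This compares the tangents of \<open>t\<close> and \<open>\<phi> 1\<close> in
    cross-multiplied form.\<close>
  then have main: "k * cos (\<phi> 1) \<le> cos s * sin (\<phi> 1)" using r by simp
  define t where "t = arccos (cos s / cos d)"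
  have quot: "0 < cos s / cos d" "cos s / cos d < 1" using cs by auto
  then have t: "0 < t" "t < pi / 2" "cos t = cos s / cos d"
    using arccos_less_pi_half[OF quot] by (auto simp: t_def)
  have "sin t = sqrt (1 - (cos s / cos d)\<^sup>2)" unfolding t_def using quot by (intro sin_arccos) auto
  also have "1 - (cos s / cos d)\<^sup>2 = (k / cos d)\<^sup>2" using cs by (simp add: k(2) power_divide field_simps)
  also have "sqrt \<dots> = k / cos d" using k cs by (intro real_sqrt_unique) auto
  finally have "sin (t - \<phi> 1) = (k * cos (\<phi> 1) - cos s * sin (\<phi> 1)) / cos d"
    by (simp add: sin_diff t(3) diff_divide_distrib)
  then have "sin (t - \<phi> 1) \<le> 0" using main cs by (simp add: divide_nonpos_pos)
  \<comment> \<open>The difference lies strictly between \<open>- pi / 2\<close> and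
    \<open>pi\<close>, so a nonpositive sine forces it to be nonpositive.\<close>
  then have "t - \<phi> 1 \<le> 0" using sin_gt_zero[of "t - \<phi> 1"] t \<phi>1 by force
  then show ?thesis by (simp add: t_def)
qed

section \<open>The extremal plane rotation\<close>

definition rotation_mat :: "nat \<Rightarrow> real \<Rightarrow> real mat" where
  "rotation_mat n \<theta> = mat n n (\<lambda>(i, j).
     if i = j then (if i < 2 then cos \<theta> else 1)
     else if i = 0 \<and> j = 1 then - sin \<theta> else if i = 1 \<and> j = 0 then sin \<theta> else 0)"

text \<open>The angles of the eigenvalues in decreasing order for \<open>\<theta> \<ge> 0\<close>,
  indexed from 1 as \<open>phases\<close> requires.\<close>

definition rotation_phases :: "nat \<Rightarrow> real \<Rightarrow> nat \<Rightarrow> real" where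
  "rotation_phases n \<theta> i = (if i = 1 then \<theta> else if i = n then - \<theta> else 0)"

text \<open>The rows are the adjoints of orthonormal eigenvectors of the rotation; the first and the last
  one belong to the eigenvalues \<open>cis \<theta>\<close> and \<open>cis (- \<theta>)\<close>, the others to \<open>1\<close>.\<close>

definition rotation_frame :: "nat \<Rightarrow> complex mat" where
  "rotation_frame n = mat n n (\<lambda>(i, j).
     if i = 0 then (if j = 0 then 1 else if j = 1 then \<i> else 0) / sqrt 2
     else if i = n - 1 then (if j = 0 then 1 else if j = 1 then - \<i> else 0) / sqrt 2
     else if j = Suc i then 1 else 0)"

lemma rotation_mat_carrier [simp]: "rotation_mat n \<theta> \<in> carrier_mat n n"
  by (simp add: rotation_mat_def)

lemma rotation_frame_carrier [simp]: "rotation_frame n \<in> carrier_mat n n"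
  by (simp add: rotation_frame_def)

lemma congruent_diag_cis_index:
  assumes T: "T \<in> carrier_mat n n" and kl: "k < n" "l < n"
  shows "(mat_adjoint T * diag_cis n \<phi> * T) $$ (k, l) = (\<Sum>i<n. cnj (T $$ (i, k)) * cis (\<phi> (Suc i)) * T $$ (i, l))"
proof -
  have T': "mat_adjoint T \<in> carrier_mat n n" using T by simp
  have "mat_adjoint T * diag_cis n \<phi> = mat n n (\<lambda>(i, j). mat_adjoint T $$ (i, j) * cis (\<phi> (Suc j)))"
    unfolding diag_cis_def by (rule mat_diag_mult_right[OF T'])
  then show ?thesis using T kl by (auto simp: scalar_prod_def atLeast0LessThan)
qed

text \<open>This is the spectral decomposition, checked entrywise: the first and last rows of the
  frame produce the rotation block, the others the identity block.\<close>

lemma rotation_mat_congruent: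
  assumes n: "n \<ge> 2"
  shows "mat_adjoint (rotation_frame n) * diag_cis n (rotation_phases n \<theta>) * rotation_frame n =
    map_mat complex_of_real (rotation_mat n \<theta>)"
proof (rule eq_matI, goal_cases)
  case (1 k l)
  then have kl: "k < n" "l < n" by (simp_all add: rotation_mat_def)
  obtain m where m: "n = Suc (Suc m)" using n by (metis Suc_le_D numeral_2_eq_2 Suc_le_mono)
  let ?T = "rotation_frame n" and ?\<phi> = "rotation_phases n \<theta>"
  have sqrt2: "complex_of_real (sqrt 2) * complex_of_real (sqrt 2) = 2"
    by (metis of_real_mult of_real_numeral real_sqrt_mult_self abs_numeral)
  have "(\<Sum>i<n. cnj (?T $$ (i, k)) * cis (?\<phi> (Suc i)) * ?T $$ (i, l)) =
      cnj (?T $$ (0, k)) * cis \<theta> * ?T $$ (0, l)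
      + (\<Sum>i<m. cnj (?T $$ (Suc i, k)) * ?T $$ (Suc i, l))
      + cnj (?T $$ (n - 1, k)) * cis (- \<theta>) * ?T $$ (n - 1, l)"
    unfolding m by (subst sum.lessThan_Suc, subst sum.lessThan_Suc_shift) (simp add: rotation_phases_def)
  \<comment> \<open>Row \<open>Suc i\<close> is the unit vector with index
    \<open>Suc (Suc i)\<close>: coordinates 0 and 1 belong to the first and last rows, which shifts
    the others by one.\<close>
  also have "(\<Sum>i<m. cnj (?T $$ (Suc i, k)) * ?T $$ (Suc i, l))
      = (\<Sum>i<m. if k = Suc (Suc i) then (if k = l then 1 else 0) else 0)"
    using kl by (intro sum.cong refl) (auto simp: m rotation_frame_def)
  also have "\<dots> = (if k = l \<and> 2 \<le> k then 1 else 0)"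
  proof (cases "2 \<le> k")
    case True
    then obtain k' where "k = Suc (Suc k')" by (metis Suc_le_D numeral_2_eq_2 Suc_le_mono)
    then show ?thesis using kl m by simp
  next
    case False
    then show ?thesis by (auto intro!: sum.neutral)
  qed
  also have "cnj (?T $$ (0, k)) * cis \<theta> * ?T $$ (0, l) + (if k = l \<and> 2 \<le> k then 1 else 0)
      + cnj (?T $$ (n - 1, k)) * cis (- \<theta>) * ?T $$ (n - 1, l) = of_real (rotation_mat n \<theta> $$ (k, l))"
    using kl sqrt2 by (auto simp: m rotation_frame_def rotation_mat_def complex_eq_iff field_simps not_le less_2_cases_iff)
  finally show ?case
    using kl congruent_diag_cis_index[OF rotation_frame_carrier kl] by (simp add: rotation_mat_def)
qed (simp_all add: rotation_mat_def rotation_frame_def)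

text \<open>The congruence at angle 0 says that the frame is unitary.\<close>

lemma rotation_frame_invertible:
  assumes "n \<ge> 2"
  shows "invertible_mat (rotation_frame n)"
proof -
  let ?T = "rotation_frame n"
  have T': "mat_adjoint ?T \<in> carrier_mat n n" by simp
  have "diag_cis n (rotation_phases n 0) = 1\<^sub>m n"
    by (rule eq_matI) (auto simp: diag_cis_def mat_diag_def rotation_phases_def)
  moreover have "map_mat complex_of_real (rotation_mat n 0) = 1\<^sub>m n"
    by (rule eq_matI) (auto simp: rotation_mat_def)
  ultimately have "mat_adjoint ?T * ?T = 1\<^sub>m n"
    using rotation_mat_congruent[OF assms, of 0] right_mult_one_mat[OF T'] by simp
  moreover from this have "?T * mat_adjoint ?T = 1\<^sub>m n"
    by (rule mat_mult_left_right_inverse[OF T' rotation_frame_carrier])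
  ultimately show ?thesis
    using carrier_matD[OF rotation_frame_carrier[of n]]
    by (auto simp: invertible_mat_def inverts_mat_def intro!: exI[of _ "mat_adjoint ?T"])
qed

lemma rotation_mat_phases:
  assumes n: "n \<ge> 2" and \<theta>: "0 \<le> \<theta>" "\<theta> < pi / 2"
  shows "phases (map_mat complex_of_real (rotation_mat n \<theta>)) (rotation_phases n \<theta>)"
proof -
  have "antimono_on {1..n} (rotation_phases n \<theta>)"
    using \<theta> by (auto intro!: monotone_onI simp: rotation_phases_def)
  moreover have "rotation_phases n \<theta> 1 = \<theta>" "rotation_phases n \<theta> n = - \<theta>"
    using n by (auto simp: rotation_phases_def)
  moreover have "dim_row (map_mat complex_of_real (rotation_mat n \<theta>)) = n"
    by (simp add: rotation_mat_def)
  ultimately show ?thesis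
    using rotation_mat_congruent[OF n, of \<theta>] rotation_frame_invertible[OF n] \<theta>
    by (auto simp: phases_def Let_def intro!: bexI[of _ "rotation_frame n"])
qed

text \<open>All phases lie strictly between \<open>- pi / 2\<close> and \<open>pi / 2\<close>, so
  the cone they span has positive real part away from 0.\<close>

lemma rotation_mat_pos_def:
  assumes n: "n \<ge> 2" and \<theta>: "0 \<le> \<theta>" "\<theta> < pi / 2"
  shows "pos_def (herm_part (map_mat complex_of_real (rotation_mat n \<theta>)))"
proof -
  let ?C = "map_mat complex_of_real (rotation_mat n \<theta>)"
  have C: "?C \<in> carrier_mat n n" by simp
  show ?thesis unfolding pos_def_herm_part_iff[OF C]
  proof (intro ballI impI)
    fix x :: "complex vec"
    assume x: "x \<in> carrier_vec n" "x \<noteq> 0\<^sub>v n"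
    obtain w where w: "(?C *\<^sub>v x) \<bullet>c x = (\<Sum>i<n. cis (rotation_phases n \<theta> (Suc i)) * of_real (w i))"
      "\<And>i. w i \<ge> 0" "\<exists>i<n. w i > 0"
      using phases_quadratic_formE[OF C rotation_mat_phases[OF n \<theta>] x] by metis
    have cos: "0 < cos (rotation_phases n \<theta> i)" for i
      using \<theta> by (intro cos_gt_zero_pi) (auto simp: rotation_phases_def)
    obtain i where i: "i < n" "w i > 0" using w(3) by auto
    have "0 < (\<Sum>i<n. cos (rotation_phases n \<theta> (Suc i)) * w i)"
      by (rule sum_pos2[of _ i]) (use i cos w(2) in \<open>auto simp: less_imp_le\<close>)
    then show "0 < Re ((?C *\<^sub>v x) \<bullet>c x)" unfolding w(1) by (simp add: Re_sum)
  qed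
qed

text \<open>In the first two coordinates, singularity of the rotation minus
  \<open>diag (e1, e2)\<close> reads \<open>cos \<theta> * (e1 + e2) = 1 + e1 * e2\<close>; half
  angles turn this into the hypothesis \<open>eq\<close>.\<close>

lemma rotation_mat_det:
  assumes n: "n \<ge> 2" and \<theta>: "sin \<theta> \<noteq> 0"
    and eq: "cos \<theta> * cos ((\<mu> 1 - \<mu> 2) / 2) = - cos ((\<mu> 1 + \<mu> 2) / 2)"
  shows "det (1\<^sub>m n + diag_cis n \<mu> * map_mat complex_of_real (rotation_mat n \<theta>)) = 0"
proof -
  let ?C = "map_mat complex_of_real (rotation_mat n \<theta>)"
  have C: "?C \<in> carrier_mat n n" by simp
  obtain m where m: "n = Suc (Suc m)" using n by (metis Suc_le_D numeral_2_eq_2 Suc_le_mono)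
  define e1 where "e1 = cis (pi - \<mu> 1)"
  define e2 where "e2 = cis (pi - \<mu> 2)"
  \<comment> \<open>The vector is chosen to satisfy row 0 identically, leaving \<open>key\<close>
    for row 1; \<open>sin \<theta> \<noteq> 0\<close> makes it nonzero.\<close>
  define x where "x = vec n (\<lambda>i. if i = 0 then of_real (sin \<theta>) else if i = 1 then of_real (cos \<theta>) - e1 else 0)"
  have x: "x \<in> carrier_vec n" by (simp add: x_def)
  have x0: "x \<noteq> 0\<^sub>v n"
  proof
    assume "x = 0\<^sub>v n"
    then have "x $ 0 = 0" using n by simp
    then show False using \<theta> n by (simp add: x_def)
  qed
  \<comment> \<open>With these half-angle factors, \<open>e1 = - u * v\<close> and
    \<open>e2 = - u * cnj v\<close>, so sum and product of \<open>e1\<close> and \<open>e2\<close>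
    become real cosines times powers of \<open>u\<close>.\<close>
  define u where "u = cis (- (\<mu> 1 + \<mu> 2) / 2)"
  define v where "v = cis ((\<mu> 2 - \<mu> 1) / 2)"
  have half: "v + cnj v = of_real (2 * cos ((\<mu> 1 - \<mu> 2) / 2))" "u + cnj u = of_real (2 * cos ((\<mu> 1 + \<mu> 2) / 2))"
  proof -
    have "cis a + cnj (cis a) = of_real (2 * cos a)" for a by (simp add: complex_eq_iff)
    moreover have "cos ((\<mu> 2 - \<mu> 1) / 2) = cos ((\<mu> 1 - \<mu> 2) / 2)"
      "cos (- (\<mu> 1 + \<mu> 2) / 2) = cos ((\<mu> 1 + \<mu> 2) / 2)"
      using cos_minus[of "(\<mu> 1 - \<mu> 2) / 2"] cos_minus[of "(\<mu> 1 + \<mu> 2) / 2"]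
      by (simp_all add: minus_divide_left del: cos_minus)
    ultimately show "v + cnj v = of_real (2 * cos ((\<mu> 1 - \<mu> 2) / 2))" "u + cnj u = of_real (2 * cos ((\<mu> 1 + \<mu> 2) / 2))"
      unfolding u_def v_def by simp_all
  qed
  have "cis (pi - a) = - cis (- a)" for a by (simp add: complex_eq_iff)
  moreover have "u * v = cis (- \<mu> 1)" "u * cnj v = cis (- \<mu> 2)"
    unfolding u_def v_def cis_cnj cis_mult by (auto intro!: arg_cong[where f = cis] simp: field_simps)
  ultimately have e: "e1 = - u * v" "e2 = - u * cnj v" by (simp_all add: e1_def e2_def)
  have uu: "u * cnj u = 1" and vv: "v * cnj v = 1" by (simp_all add: u_def v_def cis_cnj cis_mult)
  have "of_real (cos \<theta>) * (e1 + e2) = - u * of_real (cos \<theta>) * (v + cnj v)" unfolding e by (simp add: algebra_simps)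
  also have "\<dots> = - 2 * u * of_real (cos \<theta> * cos ((\<mu> 1 - \<mu> 2) / 2))" unfolding half by simp
  also have "\<dots> = u * (u + cnj u)" unfolding eq half by simp
  also have "\<dots> = 1 + e1 * e2" unfolding e using uu vv by (simp add: algebra_simps)
  finally have key: "of_real (cos \<theta>) * (e1 + e2) = 1 + e1 * e2" .
  have Cx: "(?C *\<^sub>v x) $ i = of_real (rotation_mat n \<theta> $$ (i, 0)) * of_real (sin \<theta>)
      + of_real (rotation_mat n \<theta> $$ (i, 1)) * (of_real (cos \<theta>) - e1)" if i: "i < n" for i
  proof -
    have "(?C *\<^sub>v x) $ i = (\<Sum>j<n. of_real (rotation_mat n \<theta> $$ (i, j)) * x $ j)"
      unfolding mult_mat_vec_index_sum[OF C x i] using i by (intro sum.cong refl) (simp add: rotation_mat_def)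
    also have "\<dots> = (\<Sum>j<Suc (Suc m). of_real (rotation_mat n \<theta> $$ (i, j)) * x $ j)"
      by (simp only: m)
    finally show ?thesis unfolding sum.lessThan_Suc_shift by (simp add: x_def m)
  qed
  have "(?C *\<^sub>v x) $ i = cis (pi - \<mu> (Suc i)) * x $ i" if i: "i < n" for i
  proof -
    consider "i = 0" | "i = 1" | "2 \<le> i" by linarith
    then show ?thesis
    proof cases
      case 1
      then show ?thesis unfolding Cx[OF i] using n
        by (simp add: rotation_mat_def x_def e1_def algebra_simps)
    next
      case 2
      have "of_real (sin \<theta>) * of_real (sin \<theta>) + of_real (cos \<theta>) * of_real (cos \<theta>) = (1 :: complex)"
        by (metis add.commute of_real_1 of_real_add of_real_mult sin_cos_squared_add3)
      then have "of_real (sin \<theta>) * of_real (sin \<theta>) + of_real (cos \<theta>) * (of_real (cos \<theta>) - e1) = e2 * (of_real (cos \<theta>) - e1)"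
        using key by (simp add: algebra_simps)
      then show ?thesis unfolding Cx[OF i] using n 2
        by (simp add: rotation_mat_def x_def e2_def numeral_2_eq_2)
    next
      case 3
      then show ?thesis unfolding Cx[OF i] using i
        by (simp add: rotation_mat_def x_def)
    qed
  qed
  then show ?thesis unfolding det_one_plus_diag_cis_mult_eq_0_iff[OF C] using x x0 by blast
qed

section \<open>The real radius\<close>

lemma theta_real_diag_cis:
  assumes n: "n \<ge> 2" and mono: "antimono_on {1..n} \<mu>" and spread: "\<mu> 1 - \<mu> n < pi"
    and \<mu>1: "pi / 2 < \<mu> 1" "\<mu> 1 < pi"
  shows "theta_real (diag_cis n \<mu>) =
    (if \<mu> 1 + \<mu> 2 > pi
     then ereal (arccos (- (cos ((\<mu> 1 + \<mu> 2) / 2) / cos ((\<mu> 1 - \<mu> 2) / 2)))) else \<infinity>)"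
proof -
  \<comment> \<open>With \<open>\<psi>\<close> indexed from 0, \<open>\<psi> 0 = s - d\<close> and
    \<open>\<psi> 1 = s + d\<close>; the case distinction below is whether
    \<open>s < pi / 2\<close>.\<close>
  define s where "s = pi - (\<mu> 1 + \<mu> 2) / 2"
  define d where "d = (\<mu> 1 - \<mu> 2) / 2"
  define \<psi> where "\<psi> i = pi - \<mu> (Suc i)" for i
  define S where "S = {ereal (\<phi> 1) |R D \<phi>. R \<in> carrier_mat n n \<and> D = map_mat complex_of_real R \<and>
       pos_def (herm_part D) \<and> phases D \<phi> \<and> det (1\<^sub>m n + diag_cis n \<mu> * D) = 0}"
  have S: "theta_real (diag_cis n \<mu>) = Inf S"
    unfolding theta_real_def Let_def diag_cis_dim S_def ..
  obtain m where m: "n = Suc m" using n by (cases n) auto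
  have \<mu>: "\<mu> (Suc (Suc i)) \<le> \<mu> 2" "\<mu> n \<le> \<mu> (Suc (Suc i))" if "i < m" for i
    using monotone_onD[OF mono, of 2 "Suc (Suc i)"] monotone_onD[OF mono, of "Suc (Suc i)" n] that m by auto
  have \<mu>2: "\<mu> 2 \<le> \<mu> 1" "\<mu> n \<le> \<mu> 2"
    using monotone_onD[OF mono, of 1 2] monotone_onD[OF mono, of 2 n] n by auto
  have d: "0 \<le> d" "d < pi / 2" using \<mu>2 spread by (auto simp: d_def)
  have \<psi>0: "\<psi> 0 = s - d" "0 < \<psi> 0" "\<psi> 0 < pi / 2"
    using \<mu>1 by (auto simp: \<psi>_def s_def d_def field_simps)
  have \<psi>: "s + d \<le> \<psi> (Suc i)" "\<psi> (Suc i) \<le> \<psi> 0 + pi" if "i < m" for i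
    using \<mu>[OF that] spread by (auto simp: \<psi>_def s_def d_def field_simps)
  have member: "\<exists>x\<in>carrier_vec (Suc m). x \<noteq> 0\<^sub>v (Suc m) \<and>
      (\<forall>i<Suc m. (map_mat complex_of_real R *\<^sub>v x) $ i = cis (\<psi> i) * x $ i)"
    and pos: "\<And>y. y \<in> carrier_vec (Suc m) \<Longrightarrow> y \<noteq> 0\<^sub>v (Suc m) \<Longrightarrow>
      0 < Re ((map_mat complex_of_real R *\<^sub>v y) \<bullet>c y)"
    if R: "R \<in> carrier_mat n n" and "pos_def (herm_part (map_mat complex_of_real R))"
      and "det (1\<^sub>m n + diag_cis n \<mu> * map_mat complex_of_real R) = 0" for R
  proof -
    have C: "map_mat complex_of_real R \<in> carrier_mat n n" using R by simp
    show "\<exists>x\<in>carrier_vec (Suc m). x \<noteq> 0\<^sub>v (Suc m) \<and>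
      (\<forall>i<Suc m. (map_mat complex_of_real R *\<^sub>v x) $ i = cis (\<psi> i) * x $ i)"
      using iffD1[OF det_one_plus_diag_cis_mult_eq_0_iff[OF C] that(3)] unfolding m \<psi>_def .
    show "0 < Re ((map_mat complex_of_real R *\<^sub>v y) \<bullet>c y)" if "y \<in> carrier_vec (Suc m)" "y \<noteq> 0\<^sub>v (Suc m)" for y
      using \<open>pos_def _\<close> that unfolding pos_def_herm_part_iff[OF C] m by blast
  qed
  show ?thesis
  proof (cases "\<mu> 1 + \<mu> 2 > pi")
    case False
    have "S = {}"
    proof (rule ccontr)
      assume "S \<noteq> {}"
      then obtain R where R: "R \<in> carrier_mat n n" "pos_def (herm_part (map_mat complex_of_real R))"
        "det (1\<^sub>m n + diag_cis n \<mu> * map_mat complex_of_real R) = 0" by (auto simp: S_def)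
      obtain x where x: "x \<in> carrier_vec (Suc m)" "x \<noteq> 0\<^sub>v (Suc m)"
        "\<And>i. i < Suc m \<Longrightarrow> (map_mat complex_of_real R *\<^sub>v x) $ i = cis (\<psi> i) * x $ i"
        using member[OF R] by blast
      show False
      proof (rule real_mat_infeasible[OF R(1)[unfolded m] x(1,2) pos[OF R] x(3) \<psi>0(2,3)])
        \<comment> \<open>Here \<open>s \<ge> pi / 2\<close>, so
          \<open>s + d = 2 * s - \<psi> 0\<close> is at least \<open>pi - \<psi> 0\<close>.\<close>
        show "pi - \<psi> 0 \<le> \<psi> (Suc i)" if "i < m" for i
          using \<psi>(1)[OF that] \<psi>0(1) False unfolding s_def by argo
      qed (use \<psi> in auto)
    qed
    then show ?thesis using False by (simp add: S top_ereal_def)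
  next
    case True
    define \<theta> where "\<theta> = arccos (cos s / cos d)"
    have sd: "d < s" "s < pi / 2" using True \<psi>0 by (auto simp: s_def)
    have "0 < cos s" "cos s < cos d" using sd d by (auto intro: cos_gt_zero_pi cos_monotone_0_pi)
    then have quot: "0 < cos s / cos d" "cos s / cos d < 1" "0 < cos d" by auto
    then have \<theta>: "0 < \<theta>" "\<theta> < pi / 2" "cos \<theta> = cos s / cos d"
      using arccos_less_pi_half[OF quot(1,2)] by (auto simp: \<theta>_def)
    have cos_s: "cos s = - cos ((\<mu> 1 + \<mu> 2) / 2)" by (simp add: s_def cos_diff)
    have "Inf S = ereal \<theta>"
    proof (rule antisym)
      have "cos \<theta> * cos ((\<mu> 1 - \<mu> 2) / 2) = - cos ((\<mu> 1 + \<mu> 2) / 2)"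
        using \<theta>(3) quot(3) cos_s by (simp add: d_def)
      moreover have "sin \<theta> \<noteq> 0" using sin_gt_zero[of \<theta>] \<theta> by auto
      ultimately have "det (1\<^sub>m n + diag_cis n \<mu> * map_mat complex_of_real (rotation_mat n \<theta>)) = 0"
        using rotation_mat_det[OF n] by blast
      moreover have "rotation_phases n \<theta> 1 = \<theta>" by (simp add: rotation_phases_def)
      ultimately have "ereal \<theta> \<in> S"
        unfolding S_def using rotation_mat_phases[OF n] rotation_mat_pos_def[OF n] \<theta> rotation_mat_carrier
        by (smt (verit) mem_Collect_eq)
      then show "Inf S \<le> ereal \<theta>" by (rule Inf_lower)
      show "ereal \<theta> \<le> Inf S"
      proof (rule Inf_greatest)
        fix z assume "z \<in> S"
        then obtain R \<phi> where z: "z = ereal (\<phi> 1)" and ph: "phases (map_mat complex_of_real R) \<phi>"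
          and R: "R \<in> carrier_mat n n" "pos_def (herm_part (map_mat complex_of_real R))"
          "det (1\<^sub>m n + diag_cis n \<mu> * map_mat complex_of_real R) = 0" by (auto simp: S_def)
        obtain x where x: "x \<in> carrier_vec (Suc m)" "x \<noteq> 0\<^sub>v (Suc m)"
          "\<And>i. i < Suc m \<Longrightarrow> (map_mat complex_of_real R *\<^sub>v x) $ i = cis (\<psi> i) * x $ i"
          using member[OF R] by blast
        have "\<theta> \<le> \<phi> 1" unfolding \<theta>_def
          by (rule real_mat_phase_ge[OF R(1)[unfolded m] x(1,2) pos[OF R] ph x(3) d(1) sd \<psi>0(1) \<psi>])
        then show "ereal \<theta> \<le> z" by (simp add: z)
      qed
    qed
    then show ?thesis using True by (simp add: S \<theta>_def cos_s d_def)
  qed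
qed

section \<open>Comparison of the two radii\<close>

text \<open>Expanding \<open>cos ((s - d) + d)\<close> shows
  \<open>cos s \<le> cos (s - d) * cos d\<close>, strictly for \<open>0 < d\<close>; divide by
  \<open>cos d\<close> and use that \<open>arccos\<close> decreases.\<close>

lemma arccos_quotient_bound:
  assumes "0 \<le> d" "d < s" "s < pi / 2"
  shows "s - d \<le> arccos (cos s / cos d)" "0 < d \<Longrightarrow> s - d < arccos (cos s / cos d)"
proof -
  have cs: "0 < cos s" "cos s < cos d" using assms by (auto intro: cos_gt_zero_pi cos_monotone_0_pi)
  then have quot: "0 < cos s / cos d" "cos s / cos d < 1" by auto
  have eq: "cos s = cos (s - d) * cos d - sin (s - d) * sin d"
    using cos_add[of "s - d" d] by simp
  have sd: "0 < sin (s - d)" "0 \<le> sin d" using assms by (auto intro: sin_gt_zero sin_ge_zero)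
  have arc: "arccos (cos (s - d)) = s - d" using assms by (intro arccos_cos) auto
  have "cos s / cos d \<le> cos (s - d)" using eq sd cs by (simp add: divide_le_eq)
  then show "s - d \<le> arccos (cos s / cos d)"
    using arccos_le_mono[of "cos (s - d)" "cos s / cos d"] quot arc by auto
  assume "0 < d"
  then have "0 < sin d" using assms by (intro sin_gt_zero) auto
  then have "cos s / cos d < cos (s - d)" using eq sd cs by (simp add: divide_less_eq)
  then show "s - d < arccos (cos s / cos d)"
    using arccos_less_mono[of "cos (s - d)" "cos s / cos d"] quot arc by auto
qed

theorem proposition3p4:
  fixes n :: nat and \<mu> :: "nat \<Rightarrow> real" and M :: "complex mat"
  assumes "n \<ge> 2"
    and "pi > \<mu> 1" and "antimono_on {1..n} \<mu>" and "\<mu> n > - pi / 2"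
    and "\<mu> 1 - \<mu> n < pi"
    and "M = diag_cis n \<mu>"
    and "\<mu> 1 > pi / 2"
  shows "theta_complex M = ereal (pi - \<mu> 1) \<and>
    ereal (pi - \<mu> 1) \<le> theta_real M \<and>
    theta_real M =
      (if \<mu> 1 + \<mu> 2 > pi
       then ereal (arccos (- (cos ((\<mu> 1 + \<mu> 2) / 2) / cos ((\<mu> 1 - \<mu> 2) / 2))))
       else \<infinity>) \<and>
    (\<mu> 1 > \<mu> 2 \<longrightarrow> ereal (pi - \<mu> 1) < theta_real M)"
proof -
  define s where "s = pi - (\<mu> 1 + \<mu> 2) / 2"
  define d where "d = (\<mu> 1 - \<mu> 2) / 2"
  have real: "theta_real M = (if \<mu> 1 + \<mu> 2 > pi
       then ereal (arccos (- (cos ((\<mu> 1 + \<mu> 2) / 2) / cos ((\<mu> 1 - \<mu> 2) / 2)))) else \<infinity>)"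
    unfolding assms(6) using assms by (intro theta_real_diag_cis) auto
  have complex: "theta_complex M = ereal (pi - \<mu> 1)"
    unfolding assms(6) using assms by (intro theta_complex_diag_cis) auto
  have "\<mu> 2 \<le> \<mu> 1" using monotone_onD[OF assms(3), of 1 2] assms(1) by simp
  then have d: "0 \<le> d" and d': "\<mu> 2 < \<mu> 1 \<Longrightarrow> 0 < d" by (auto simp: d_def)
  have sd: "s - d = pi - \<mu> 1" by (simp add: s_def d_def field_simps)
  have "cos s = - cos ((\<mu> 1 + \<mu> 2) / 2)" by (simp add: s_def cos_diff)
  then have arc: "arccos (cos s / cos d) = arccos (- (cos ((\<mu> 1 + \<mu> 2) / 2) / cos ((\<mu> 1 - \<mu> 2) / 2)))"
    by (simp add: d_def)
  \<comment> \<open>If \<open>s < pi / 2\<close>, the arccosine bound applies with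
    \<open>s - d = pi - \<mu> 1\<close>; otherwise the real radius is infinite and both inequalities
    are immediate.\<close>
  have "s < pi / 2 \<longleftrightarrow> pi < \<mu> 1 + \<mu> 2" by (auto simp: s_def)
  moreover have "d < s" using sd assms(2) by linarith
  ultimately have "ereal (pi - \<mu> 1) \<le> theta_real M" "\<mu> 1 > \<mu> 2 \<longrightarrow> ereal (pi - \<mu> 1) < theta_real M"
    using arccos_quotient_bound[OF d] d' unfolding real arc[symmetric] sd[symmetric] by auto
  then show ?thesis using complex real by blast
qed

end
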